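(* Let $A$ be a set of atoms. For all terms $s,t$ (possibly containing variables) over the signature $\Sigma_{\mathrm{SCL}}(A)=\{\wedge,\vee,\neg,\mathsf T,\mathsf F\}\cup A$, $$\mathrm{CL}_2\vdash s=t\iff \mathrm{C\ell SCL}_2\vdash s=t.$$
   Context: $\vdash$ denotes derivability in equational logic (variables in axioms may be instantiated by arbitrary terms). Here $\wedge,\vee$ are binary symbols for the (noncommutative) short-circuit conjunction and disjunction, $\neg$ is unary, and $\mathsf T,\mathsf F$ and all atoms $a\in A$ are constants. $\mathrm{CL}_2$ is the equational theory with the axioms: (a) $\neg\neg x=x$; (b) $\neg(x\wedge y)=\neg x\vee\neg y$; (c) $(x\wedge y)\wedge z=x\wedge(y\wedge z)$; (d) $x\wedge(y\vee z)=(x\wedge y)\vee(x\wedge z)$; (e) $(x\vee y)\wedge z=(x\wedge z)\vee(\neg x\wedge y\wedge z)$ (bracketing immaterial by (c)); (f) $x\vee(x\wedge y)=x$; (g) $(x\wedge y)\vee(y\wedge x)=(y\wedge x)\vee(x\wedge y)$; together with $\mathsf T\wedge x=x$ and $\neg\mathsf T=\mathsf F$. The ternary conditional is written $x\lhd y\rhd z$ ("if $y$ then $x$ else $z$"). $\mathrm{CP}$ consists of: $x\lhd\mathsf T\rhd y=x$; $x\lhd\mathsf F\rhd y=y$; $\mathsf T\lhd x\rhd\mathsf F=x$; $x\lhd(y\lhd z\rhd u)\rhd v=(x\lhd y\rhd v)\lhd z\rhd(x\lhd u\rhd v)$. $\mathrm{CP}_{mem}$ is $\mathrm{CP}$ plus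 $x\lhd y\rhd(z\lhd u\rhd(v\lhd y\rhd w))=x\lhd y\rhd(z\lhd u\rhd w)$. $\mathrm{CP}_{cl}$ is $\mathrm{CP}_{mem}$ plus $(x\lhd y\rhd z)\lhd u\rhd(v\lhd y\rhd w)=(x\lhd u\rhd v)\lhd y\rhd(z\lhd u\rhd w)$. $\mathrm{C\ell SCL}_2$ (two-valued conditional short-circuit logic) is the set of consequences, restricted to the signature without the conditional, of $\mathrm{CP}_{cl}\cup\{\neg x=\mathsf F\lhd x\rhd\mathsf T,\ x\wedge y=y\lhd x\rhd\mathsf F\}$, where additionally $\mathsf F=\neg\mathsf T$ and $x\vee y=\neg(\neg x\wedge\neg y)$. That is, for terms $s,t$ over $\Sigma_{\mathrm{SCL}}(A)$, $\mathrm{C\ell SCL}_2\vdash s=t$ means that $s=t$ is derivable from all these equations in the combined signature. *)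

theory Defs
  imports Main
begin

datatype 'f trm = Var nat | Fun 'f "'f trm list"

primrec subst :: "(nat \<Rightarrow> 'f trm) \<Rightarrow> 'f trm \<Rightarrow> 'f trm" where
  "subst \<sigma> (Var x) = \<sigma> x"
| "subst \<sigma> (Fun f ts) = Fun f (map (subst \<sigma>) ts)"

text \<open>A signature is a set of function symbols paired with their arities.\<close>

type_synonym 'f signature = "('f \<times> nat) set"

inductive_set terms_over :: "'f signature \<Rightarrow> 'f trm set" for \<Sigma> where
  Var: "Var x \<in> terms_over \<Sigma>"
| Fun: "(f, length ts) \<in> \<Sigma> \<Longrightarrow> (\<And>t. t \<in> set ts \<Longrightarrow> t \<in> terms_over \<Sigma>)
    \<Longrightarrow> Fun f ts \<in> terms_over \<Sigma>"

text \<open>An equation is a pair of terms; \<open>\<Sigma>, E \<turnstile> s \<doteq> t\<close> is derivability with every term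
  in the derivation built over \<open>\<Sigma>\<close> (the equations in \<open>E\<close> are meant to be over \<open>\<Sigma>\<close>).\<close>

type_synonym 'f equation = "'f trm \<times> 'f trm"

abbreviation (input) equation :: "'f trm \<Rightarrow> 'f trm \<Rightarrow> 'f equation" (infix "\<approx>" 50) where
  "s \<approx> t \<equiv> (s, t)"

inductive derivable :: "'f signature \<Rightarrow> 'f equation set \<Rightarrow> 'f trm \<Rightarrow> 'f trm \<Rightarrow> bool"
    ("_, _ \<turnstile> _ \<doteq> _" [51, 51, 51, 51] 50) for \<Sigma> E where
  axiom: "(l \<approx> r) \<in> E \<Longrightarrow> (\<And>x. \<sigma> x \<in> terms_over \<Sigma>) \<Longrightarrow> \<Sigma>, E \<turnstile> subst \<sigma> l \<doteq> subst \<sigma> r"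
| refl: "t \<in> terms_over \<Sigma> \<Longrightarrow> \<Sigma>, E \<turnstile> t \<doteq> t"
| sym: "\<Sigma>, E \<turnstile> s \<doteq> t \<Longrightarrow> \<Sigma>, E \<turnstile> t \<doteq> s"
| trans: "\<Sigma>, E \<turnstile> s \<doteq> t \<Longrightarrow> \<Sigma>, E \<turnstile> t \<doteq> u \<Longrightarrow> \<Sigma>, E \<turnstile> s \<doteq> u"
| cong: "(f, length ss) \<in> \<Sigma> \<Longrightarrow> list_all2 (\<lambda>s t. \<Sigma>, E \<turnstile> s \<doteq> t) ss ts
    \<Longrightarrow> \<Sigma>, E \<turnstile> Fun f ss \<doteq> Fun f ts"

datatype 'a symbol = TrueS | FalseS | AtomS 'a | NegS | ConjS | DisjS | CondS

text \<open>The set of atoms is an explicit set rather than a type so that it may be empty.\<close>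

definition Sigma_SCL :: "'a set \<Rightarrow> 'a symbol signature" where
  "Sigma_SCL A = {(ConjS, 2), (DisjS, 2), (NegS, 1), (TrueS, 0), (FalseS, 0)}
     \<union> (\<lambda>a. (AtomS a, 0)) ` A"

definition Sigma_combined :: "'a set \<Rightarrow> 'a symbol signature" where
  "Sigma_combined A = Sigma_SCL A \<union> {(CondS, 3)}"

abbreviation tT :: "'a symbol trm" where "tT \<equiv> Fun TrueS []"
abbreviation tF :: "'a symbol trm" where "tF \<equiv> Fun FalseS []"

abbreviation neg :: "'a symbol trm \<Rightarrow> 'a symbol trm" ("\<^bold>\<not> _" [75] 75) where
  "\<^bold>\<not> x \<equiv> Fun NegS [x]"

abbreviation conj :: "'a symbol trm \<Rightarrow> 'a symbol trm \<Rightarrow> 'a symbol trm"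
    (infix "\<^bold>\<and>" 70) where
  "x \<^bold>\<and> y \<equiv> Fun ConjS [x, y]"

abbreviation disj :: "'a symbol trm \<Rightarrow> 'a symbol trm \<Rightarrow> 'a symbol trm"
    (infix "\<^bold>\<or>" 65) where
  "x \<^bold>\<or> y \<equiv> Fun DisjS [x, y]"

text \<open>\<open>x \<lhd> y \<rhd> z\<close> reads ``if \<open>y\<close> then \<open>x\<close> else \<open>z\<close>''.\<close>

abbreviation cond :: "'a symbol trm \<Rightarrow> 'a symbol trm \<Rightarrow> 'a symbol trm \<Rightarrow> 'a symbol trm"
    ("_ \<lhd> _ \<rhd> _" [61, 61, 61] 60) where
  "x \<lhd> y \<rhd> z \<equiv> Fun CondS [x, y, z]"

definition CL2 :: "'a symbol equation set" where
  "CL2 = (let x = Var 0; y = Var 1; z = Var 2 in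
   {\<^bold>\<not> (\<^bold>\<not> x) \<approx> x,
    \<^bold>\<not> (x \<^bold>\<and> y) \<approx> \<^bold>\<not> x \<^bold>\<or> \<^bold>\<not> y,
    (x \<^bold>\<and> y) \<^bold>\<and> z \<approx> x \<^bold>\<and> (y \<^bold>\<and> z),
    x \<^bold>\<and> (y \<^bold>\<or> z) \<approx> (x \<^bold>\<and> y) \<^bold>\<or> (x \<^bold>\<and> z),
    (x \<^bold>\<or> y) \<^bold>\<and> z \<approx> (x \<^bold>\<and> z) \<^bold>\<or> (\<^bold>\<not> x \<^bold>\<and> (y \<^bold>\<and> z)),
    x \<^bold>\<or> (x \<^bold>\<and> y) \<approx> x,
    (x \<^bold>\<and> y) \<^bold>\<or> (y \<^bold>\<and> x) \<approx> (y \<^bold>\<and> x) \<^bold>\<or> (x \<^bold>\<and> y),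
    tT \<^bold>\<and> x \<approx> x,
    \<^bold>\<not> tT \<approx> tF})"

definition CP :: "'a symbol equation set" where
  "CP = (let x = Var 0; y = Var 1; z = Var 2; u = Var 3; v = Var 4 in
   {x \<lhd> tT \<rhd> y \<approx> x,
    x \<lhd> tF \<rhd> y \<approx> y,
    tT \<lhd> x \<rhd> tF \<approx> x,
    x \<lhd> (y \<lhd> z \<rhd> u) \<rhd> v \<approx> (x \<lhd> y \<rhd> v) \<lhd> z \<rhd> (x \<lhd> u \<rhd> v)})"

definition CP_mem :: "'a symbol equation set" where
  "CP_mem = CP \<union>
   (let x = Var 0; y = Var 1; z = Var 2; u = Var 3; v = Var 4; w = Var 5 in
   {x \<lhd> y \<rhd> (z \<lhd> u \<rhd> (v \<lhd> y \<rhd> w)) \<approx> x \<lhd> y \<rhd> (z \<lhd> u \<rhd> w)})"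

definition CP_cl :: "'a symbol equation set" where
  "CP_cl = CP_mem \<union>
   (let x = Var 0; y = Var 1; z = Var 2; u = Var 3; v = Var 4; w = Var 5 in
   {(x \<lhd> y \<rhd> z) \<lhd> u \<rhd> (v \<lhd> y \<rhd> w) \<approx> (x \<lhd> u \<rhd> v) \<lhd> y \<rhd> (z \<lhd> u \<rhd> w)})"

definition ClSCL2_equations :: "'a symbol equation set" where
  "ClSCL2_equations = CP_cl \<union>
   (let x = Var 0; y = Var 1 in
   {\<^bold>\<not> x \<approx> tF \<lhd> x \<rhd> tT,
    x \<^bold>\<and> y \<approx> y \<lhd> x \<rhd> tF,
    tF \<approx> \<^bold>\<not> tT,
    x \<^bold>\<or> y \<approx> \<^bold>\<not> (\<^bold>\<not> x \<^bold>\<and> \<^bold>\<not> y)})"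

definition CL2_derives :: "'a set \<Rightarrow> 'a symbol trm \<Rightarrow> 'a symbol trm \<Rightarrow> bool" where
  "CL2_derives A s t \<longleftrightarrow> Sigma_SCL A, CL2 \<turnstile> s \<doteq> t"

text \<open>Only \<open>s\<close> and \<open>t\<close> are conditional-free; intermediate terms, and those substituted for the
  variables of the equations, may contain the conditional.\<close>

definition ClSCL2_derives :: "'a set \<Rightarrow> 'a symbol trm \<Rightarrow> 'a symbol trm \<Rightarrow> bool" where
  "ClSCL2_derives A s t \<longleftrightarrow> s \<in> terms_over (Sigma_SCL A) \<and> t \<in> terms_over (Sigma_SCL A) \<and>
     (Sigma_combined A, ClSCL2_equations \<turnstile> s \<doteq> t)"

end

theory Submission
  imports Defs
begin

text \<open>
  The models of \<open>CL2\<close> are the C-algebras (with constants) of Guzman and Squier. In a C-algebra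
  the conditional is definable as \<open>x \<lhd> y \<rhd> z = (y \<and> x) \<or> (\<not> y \<and> z)\<close>, and conversely the short-circuit
  connectives are definable from the conditional, so the two sets of axioms have the same models up
  to definitional extension. The two hard identities are the commutation
  \<open>(y \<and> x) \<or> (\<not> y \<and> z) = (\<not> y \<and> z) \<or> (y \<and> x)\<close>, obtained by applying axiom (g) to \<open>\<not> y \<or> x\<close> and
  \<open>y \<or> z\<close>, and the exchange axiom of \<open>CP_cl\<close>, which comes down to the commutation of the tests
  \<open>y \<or> \<not> y\<close> and \<open>u \<or> \<not> u\<close>.

  Since the axioms contain no atoms, both semantic arguments are carried out in the free algebras
  over the empty set of atoms; a translation eliminating the conditional then turns derivations
  into derivations.
\<close>

section \<open>Identities of C-algebras\<close>

locale c_algebra =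
  fixes neg :: "'b \<Rightarrow> 'b" and con :: "'b \<Rightarrow> 'b \<Rightarrow> 'b" (infixr "\<sqinter>" 70)
    and dis :: "'b \<Rightarrow> 'b \<Rightarrow> 'b" (infixr "\<squnion>" 65) and T F :: 'b
  assumes neg_neg: "neg (neg x) = x"
    and neg_con: "neg (x \<sqinter> y) = neg x \<squnion> neg y"
    and con_assoc: "(x \<sqinter> y) \<sqinter> z = x \<sqinter> (y \<sqinter> z)"
    and con_dis: "x \<sqinter> (y \<squnion> z) = (x \<sqinter> y) \<squnion> (x \<sqinter> z)"
    and dis_con: "(x \<squnion> y) \<sqinter> z = (x \<sqinter> z) \<squnion> (neg x \<sqinter> (y \<sqinter> z))"
    and dis_absorb: "x \<squnion> (x \<sqinter> y) = x"
    and comm: "(x \<sqinter> y) \<squnion> (y \<sqinter> x) = (y \<sqinter> x) \<squnion> (x \<sqinter> y)"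
    and T_con: "T \<sqinter> x = x"
    and neg_T: "neg T = F"
begin

text \<open>With \<open>neg_con\<close>, negation exchanges the two connectives, so each identity
  below yields its dual.\<close>

lemma neg_dis: "neg (x \<squnion> y) = neg x \<sqinter> neg y"
  by (metis neg_con neg_neg)

lemma dis_assoc: "(x \<squnion> y) \<squnion> z = x \<squnion> (y \<squnion> z)"
  by (metis neg_con neg_dis con_assoc neg_neg)

lemma dis_con_distrib: "x \<squnion> (y \<sqinter> z) = (x \<squnion> y) \<sqinter> (x \<squnion> z)"
  by (metis neg_con neg_dis con_dis neg_neg)

lemma con_dis_dual: "(x \<sqinter> y) \<squnion> z = (x \<squnion> z) \<sqinter> (neg x \<squnion> (y \<squnion> z))"
  by (metis neg_con neg_dis dis_con neg_neg)

lemma con_absorb: "x \<sqinter> (x \<squnion> y) = x"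
  by (metis neg_con neg_dis dis_absorb neg_neg)

lemma neg_F: "neg F = T"
  by (metis neg_T neg_neg)

lemma F_dis: "F \<squnion> x = x"
  by (metis T_con neg_T neg_con neg_neg)

lemma T_dis: "T \<squnion> x = T"
  by (metis T_con dis_absorb)

lemma F_con: "F \<sqinter> x = F"
  by (metis F_dis con_absorb)

lemma con_idem: "x \<sqinter> x = x"
  by (metis dis_absorb con_absorb)

lemma dis_idem: "x \<squnion> x = x"
  by (metis dis_absorb con_absorb)

text \<open>Since \<open>T \<squnion> y = T\<close>, expanding
  \<open>(T \<squnion> y) \<sqinter> z\<close> by \<open>dis_con\<close> gives
  \<open>z = z \<squnion> F\<close>, the dual of the claim.\<close>

lemma con_T: "x \<sqinter> T = x"
  by (metis F_con T_con T_dis dis_con neg_F neg_T neg_dis neg_neg)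

lemma dis_F: "x \<squnion> F = x"
  by (metis con_T neg_T neg_con neg_neg)

text \<open>This is \<open>con_dis_dual\<close> with \<open>F\<close> as its last disjunct.\<close>

lemma con_neg_dis: "x \<sqinter> (neg x \<squnion> y) = x \<sqinter> y"
  by (metis con_dis_dual dis_F)

lemma dis_neg_con: "x \<squnion> (neg x \<sqinter> y) = x \<squnion> y"
  by (metis con_T dis_con)

text \<open>After \<open>x\<close>, the factor \<open>y \<sqinter> x\<close> may be replaced by
  \<open>neg x \<squnion> (y \<sqinter> x)\<close>. Distributing produces
  \<open>neg x \<squnion> x\<close>, which equals \<open>neg x \<squnion> T\<close>, so the second
  \<open>x\<close> can be exchanged for \<open>T\<close>.\<close>

lemma con_mem: "x \<sqinter> (y \<sqinter> x) = x \<sqinter> y"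
  by (metis con_T con_neg_dis dis_con_distrib dis_neg_con neg_neg)

lemma dis_mem: "x \<squnion> (y \<squnion> x) = x \<squnion> y"
  by (metis con_mem neg_dis neg_neg)

lemma con_left_idem: "x \<sqinter> (x \<sqinter> y) = x \<sqinter> y"
  by (metis con_assoc con_idem)

lemma con_left_mem: "x \<sqinter> (y \<sqinter> (x \<sqinter> z)) = x \<sqinter> (y \<sqinter> z)"
  by (metis con_assoc con_mem)

text \<open>\<open>x \<sqinter> neg x\<close> equals \<open>x \<sqinter> F\<close>, and
  \<open>F\<close> swallows what follows. The right side is not \<open>F\<close> in general, since
  \<open>x\<close> may be undefined in the three-valued reading.\<close>

lemma con_neg_zero: "x \<sqinter> (neg x \<sqinter> y) = x \<sqinter> neg x"
  by (metis F_con con_assoc con_neg_dis dis_F)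

lemma dis_neg_one: "x \<squnion> (neg x \<squnion> y) = x \<squnion> neg x"
  by (metis con_neg_zero neg_dis neg_neg)

lemma con_dis_neg: "x \<sqinter> (y \<squnion> neg x) = x \<sqinter> y"
  by (metis con_neg_dis dis_mem)

lemma con_dis_zero: "x \<sqinter> (y \<squnion> (neg x \<sqinter> z)) = x \<sqinter> y"
  by (metis F_dis con_dis con_dis_neg con_neg_zero dis_F)

section \<open>The conditional defined in a C-algebra\<close>

definition ite :: "'b \<Rightarrow> 'b \<Rightarrow> 'b \<Rightarrow> 'b" where
  "ite x y z = (y \<sqinter> x) \<squnion> (neg y \<sqinter> z)"

lemma ite_alt_commuted: "(neg y \<squnion> x) \<sqinter> (y \<squnion> z) = (neg y \<sqinter> z) \<squnion> (y \<sqinter> x)"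
proof -
  \<comment> \<open>\<open>con_mem\<close> inserts a second \<open>y\<close> after \<open>x\<close>,
    and this copy absorbs \<open>y \<squnion> z\<close>.\<close>
  have "y \<sqinter> (x \<sqinter> (y \<squnion> z)) = y \<sqinter> x"
    by (metis con_absorb con_assoc con_mem)
  moreover have "neg y \<sqinter> (y \<squnion> z) = neg y \<sqinter> z"
    by (metis con_neg_dis neg_neg)
  ultimately show ?thesis
    by (simp add: dis_con neg_neg)
qed

lemma ite_commuted: "ite x y z = (neg y \<sqinter> z) \<squnion> (y \<sqinter> x)"
proof -
  let ?a = "y \<sqinter> x" and ?b = "neg y \<sqinter> z"
  let ?p = "neg y \<squnion> x" and ?q = "y \<squnion> z"
  have pq: "?p \<sqinter> ?q = ?b \<squnion> ?a" and qp: "?q \<sqinter> ?p = ?a \<squnion> ?b"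
    using ite_alt_commuted[of y x z] ite_alt_commuted[of "neg y" z x] by (simp_all add: neg_neg)
  \<comment> \<open>\<open>comm\<close> reads \<open>(?b \<squnion> ?a) \<squnion> (?a \<squnion>
    ?b) = (?a \<squnion> ?b) \<squnion> (?b \<squnion> ?a)\<close>; idempotence and
    \<open>dis_mem\<close> shrink the sides to \<open>?b \<squnion> ?a\<close> and
    \<open>?a \<squnion> ?b\<close>.\<close>
  show ?thesis
    using comm[of ?p ?q] unfolding pq qp ite_def by (metis dis_assoc dis_idem dis_mem)
qed

lemma ite_alt: "ite x y z = (neg y \<squnion> x) \<sqinter> (y \<squnion> z)"
  by (simp add: ite_alt_commuted ite_commuted)

lemma ite_neg: "ite x (neg y) z = ite z y x"
  by (metis ite_commuted ite_def neg_neg)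

text \<open>De Morgan turns the sum form of the left side into the product form
  \<open>ite_alt\<close> of the right side.\<close>

lemma neg_ite: "neg (ite x y z) = ite (neg x) y (neg z)"
  by (metis ite_alt ite_def neg_con neg_dis neg_neg)

text \<open>Disjunction does not commute in general, but blocks guarded by \<open>y\<close> and
  \<open>neg y\<close> do. Two such swaps bring the summands with equal guards together.\<close>

lemma ite_dis: "ite x y z \<squnion> ite v y w = ite (x \<squnion> v) y (z \<squnion> w)"
proof -
  have "ite x y z \<squnion> ite v y w = (y \<sqinter> x) \<squnion> ((neg y \<sqinter> z) \<squnion> ((neg y \<sqinter> w) \<squnion> (y \<sqinter> v)))"
    by (simp add: ite_def[of x] ite_commuted[of v] dis_assoc)
  also have "\<dots> = (y \<sqinter> x) \<squnion> ite v y (z \<squnion> w)"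
    by (simp add: ite_commuted dis_assoc con_dis)
  also have "\<dots> = ite (x \<squnion> v) y (z \<squnion> w)"
    by (simp add: ite_def dis_assoc con_dis)
  finally show ?thesis .
qed

lemma ite_con: "ite x y z \<sqinter> w = ite (x \<sqinter> w) y (z \<sqinter> w)"
proof -
  let ?b = "neg y \<sqinter> (z \<sqinter> w)"
  \<comment> \<open>The surplus summand that \<open>dis_con\<close> creates. Being guarded by
    \<open>y\<close>, it trades places with \<open>?b\<close> and is then absorbed by
    \<open>y \<sqinter> (x \<sqinter> w)\<close>.\<close>
  let ?d = "y \<sqinter> (neg x \<sqinter> ?b)"
  have 1: "ite x y z \<sqinter> w = (y \<sqinter> (x \<sqinter> w)) \<squnion> (neg (y \<sqinter> x) \<sqinter> ?b)"
    by (simp add: ite_def dis_con con_assoc)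
  have "neg (y \<sqinter> x) \<sqinter> ?b = ?b \<squnion> ?d"
    by (simp add: neg_con dis_con neg_neg con_left_idem)
  then have 2: "neg (y \<sqinter> x) \<sqinter> ?b = ?d \<squnion> ?b"
    by (metis ite_def ite_commuted)
  have "(y \<sqinter> (x \<sqinter> w)) \<squnion> ?d = y \<sqinter> ((x \<squnion> (neg y \<sqinter> z)) \<sqinter> w)"
    by (simp add: con_dis dis_con con_assoc)
  also have "\<dots> = y \<sqinter> (x \<sqinter> w)"
    by (metis con_assoc con_dis_zero)
  finally have 3: "(y \<sqinter> (x \<sqinter> w)) \<squnion> ?d = y \<sqinter> (x \<sqinter> w)" .
  show ?thesis
    using 1 2 3 dis_assoc ite_def by metis
qed

lemma ite_T: "ite x T y = x"
  by (simp add: ite_def T_con neg_T F_con dis_F)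

lemma ite_F: "ite x F y = y"
  by (simp add: ite_def F_con neg_F T_con F_dis)

lemma T_ite_F: "ite T x F = x"
  by (metis con_T dis_F dis_neg_con ite_def)

text \<open>Unfolding the outer conditional leaves negation, conjunction from the right and
  disjunction of conditionals on \<open>z\<close>, all of which act branchwise.\<close>

lemma ite_ite: "ite x (ite y z u) v = ite (ite x y v) z (ite x u v)"
  unfolding ite_def[of x "ite y z u"] neg_ite ite_con ite_dis by (simp add: ite_def)

text \<open>Lets a guard be copied into both branches of a later conditional, so that these may be
  rewritten under it.\<close>

lemma con_ite_con: "x \<sqinter> ite (x \<sqinter> y) u (x \<sqinter> z) = x \<sqinter> ite y u z"
  by (simp add: ite_def con_dis con_left_mem con_assoc)

lemma con_ite_same: "y \<sqinter> ite v y w = y \<sqinter> v"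
  by (metis con_assoc con_dis_zero con_idem ite_def)

lemma neg_con_ite_same: "neg y \<sqinter> ite v y w = neg y \<sqinter> w"
  by (metis con_ite_same ite_neg)

text \<open>The else branch is guarded by \<open>neg y\<close>; copied inwards, this guard selects
  \<open>w\<close> from \<open>ite v y w\<close>.\<close>

lemma ite_memory: "ite x y (ite z u (ite v y w)) = ite x y (ite z u w)"
  by (metis con_ite_con ite_def neg_con_ite_same)

lemma neg_eq_ite: "neg x = ite F x T"
  by (metis T_ite_F neg_F neg_T neg_ite)

lemma con_eq_ite: "x \<sqinter> y = ite y x F"
  by (metis F_con T_con T_ite_F ite_con)

section \<open>Commuting tests and the exchange law\<close>

definition test :: "'b \<Rightarrow> 'b" where
  "test x = x \<squnion> neg x"

text \<open>A test evaluates \<open>x\<close> and discards its truth value, so both branches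
  continue alike.\<close>

lemma test_con: "test x \<sqinter> y = ite y x y"
  by (metis test_def con_mem con_assoc con_idem con_neg_zero dis_con dis_neg_con neg_neg neg_con ite_def)

text \<open>In the three-valued reading a conjunction of tests is never false, so the second
  disjunct never decides the value.\<close>

lemma test_con_absorb: "(test x \<sqinter> test y) \<squnion> (test y \<sqinter> test x) = test x \<sqinter> test y"
  unfolding test_def
  by (smt (verit) comm con_assoc con_dis con_dis_neg con_idem con_mem con_neg_dis con_neg_zero dis_con
    dis_mem dis_neg_con dis_neg_one neg_con neg_dis neg_neg)

lemma test_comm: "test x \<sqinter> test y = test y \<sqinter> test x"
  by (metis comm test_con_absorb)

lemma test_con_ite: "test y \<sqinter> ite x y z = ite x y z"
  by (metis test_con con_ite_same neg_con_ite_same ite_def)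

text \<open>Splitting the left side \<open>?L\<close> on \<open>y\<close> shows that
  \<open>test y \<sqinter> ?L\<close> is the right side. As \<open>test u\<close> fixes
  \<open>?L\<close> and tests commute, \<open>test y \<sqinter> ?L = test u \<sqinter> (test y
  \<sqinter> ?L)\<close>, which splitting on \<open>u\<close> reduces to \<open>?L\<close>.\<close>

lemma ite_exchange: "ite (ite x y z) u (ite v y w) = ite (ite x u v) y (ite z u w)"
proof -
  let ?L = "ite (ite x y z) u (ite v y w)"
  have "y \<sqinter> ?L = y \<sqinter> ite x u v"
    by (metis con_ite_con con_ite_same)
  moreover have "neg y \<sqinter> ?L = neg y \<sqinter> ite z u w"
    by (metis con_ite_con neg_con_ite_same)
  ultimately have "test y \<sqinter> ?L = ite (ite x u v) y (ite z u w)"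
    by (simp add: test_con ite_def)
  moreover have "test u \<sqinter> (test y \<sqinter> ?L) = ?L"
  proof -
    \<comment> \<open>\<open>con_left_mem\<close> carries \<open>u\<close> past
      \<open>test y\<close>, where it selects a branch of \<open>?L\<close>; that branch is a
      conditional on \<open>y\<close>, so \<open>test y\<close> leaves it unchanged.\<close>
    have "u \<sqinter> (test y \<sqinter> ?L) = u \<sqinter> ite x y z"
      by (metis con_left_mem con_ite_same test_con_ite)
    moreover have "neg u \<sqinter> (test y \<sqinter> ?L) = neg u \<sqinter> ite v y w"
      by (metis con_left_mem neg_con_ite_same test_con_ite)
    ultimately show ?thesis
      by (simp add: test_con[of u] ite_def)
  qed
  moreover have "test u \<sqinter> ?L = ?L"
    by (rule test_con_ite)
  ultimately show ?thesis
    by (metis con_assoc test_comm)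
qed

end

section \<open>Algebras of the conditional and their C-algebra structure\<close>

locale ite_algebra =
  fixes ite :: "'b \<Rightarrow> 'b \<Rightarrow> 'b \<Rightarrow> 'b" and neg :: "'b \<Rightarrow> 'b"
    and con :: "'b \<Rightarrow> 'b \<Rightarrow> 'b" (infixr "\<sqinter>" 70)
    and dis :: "'b \<Rightarrow> 'b \<Rightarrow> 'b" (infixr "\<squnion>" 65) and T F :: 'b
  assumes ite_T: "ite x T y = x"
    and ite_F: "ite x F y = y"
    and T_ite_F: "ite T x F = x"
    and ite_ite: "ite x (ite y z u) v = ite (ite x y v) z (ite x u v)"
    and ite_memory: "ite x y (ite z u (ite v y w)) = ite x y (ite z u w)"
    and ite_exchange: "ite (ite x y z) u (ite v y w) = ite (ite x u v) y (ite z u w)"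
    and neg_def: "neg x = ite F x T"
    and con_def: "x \<sqinter> y = ite y x F"
    and dis_def: "x \<squnion> y = neg (neg x \<sqinter> neg y)"
begin

lemma neg_neg: "neg (neg x) = x"
  by (metis ite_T ite_F T_ite_F ite_ite neg_def)

lemma ite_neg: "ite x (neg y) z = ite z y x"
  by (metis ite_T ite_F ite_ite neg_def)

lemma neg_ite: "neg (ite x y z) = ite (neg x) y (neg z)"
  by (metis ite_ite neg_def)

lemma dis_ite: "x \<squnion> y = ite T x y"
  by (metis con_def ite_F T_ite_F dis_def ite_neg neg_def neg_ite)

lemma ite_con: "ite x (y \<sqinter> z) w = ite (ite x z w) y w"
  by (metis con_def ite_F ite_ite)

lemma ite_dis: "ite x (y \<squnion> z) w = ite x y (ite x z w)"
  by (metis ite_T ite_ite dis_ite)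

lemma ite_memory_right: "ite x y (ite v y w) = ite x y w"
  by (metis ite_F ite_memory)

text \<open>The mirror image of \<open>ite_memory\<close>, obtained by replacing the guard
  \<open>y\<close> with \<open>neg y\<close>.\<close>

lemma ite_memory_left: "ite (ite z u (ite v y w)) y x = ite (ite z u v) y x"
  by (metis ite_neg ite_memory neg_def)

lemma neg_con: "neg (x \<sqinter> y) = neg x \<squnion> neg y"
  by (simp add: dis_def neg_neg)

lemma con_assoc: "(x \<sqinter> y) \<sqinter> z = x \<sqinter> (y \<sqinter> z)"
  by (metis con_def ite_con)

lemma con_dis: "x \<sqinter> (y \<squnion> z) = (x \<sqinter> y) \<squnion> (x \<sqinter> z)"
  by (metis con_def dis_ite ite_con ite_memory_left ite_memory_right)

lemma dis_con: "(x \<squnion> y) \<sqinter> z = (x \<sqinter> z) \<squnion> (neg x \<sqinter> (y \<sqinter> z))"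
  by (metis con_def T_ite_F dis_ite ite_con ite_dis ite_neg ite_memory_left ite_memory_right neg_def)

lemma dis_absorb: "x \<squnion> (x \<sqinter> y) = x"
  by (metis con_def T_ite_F dis_ite ite_memory_right)

text \<open>A normal form testing \<open>y\<close> in both branches of \<open>x\<close>;
  \<open>ite_exchange\<close> swaps \<open>x\<close> and \<open>y\<close> in it, which is axiom
  (g).\<close>

lemma con_dis_con: "(x \<sqinter> y) \<squnion> (y \<sqinter> x) = ite (ite T y F) x (ite F y F)"
proof -
  have "(x \<sqinter> y) \<squnion> (y \<sqinter> x) = ite (ite T y (ite x y F)) x (ite x y F)"
    by (simp add: dis_ite ite_con) (simp add: con_def)
  also have "\<dots> = ite (ite T y F) x (ite x y F)"
    by (simp add: ite_memory_right)
  \<comment> \<open>In the else branch \<open>x\<close> is false: written as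
    \<open>ite T x F\<close> and moved to the else position by negating \<open>y\<close>, it becomes
    \<open>F\<close> by \<open>ite_memory\<close>.\<close>
  also have "ite (ite T y F) x (ite x y F) = ite (ite T y F) x (ite F y F)"
    by (metis T_ite_F ite_neg ite_memory)
  finally show ?thesis .
qed

lemma c_algebra: "c_algebra neg (\<sqinter>) (\<squnion>) T F"
proof
  show "(x \<sqinter> y) \<squnion> (y \<sqinter> x) = (y \<sqinter> x) \<squnion> (x \<sqinter> y)" for x y
    by (simp add: con_dis_con ite_exchange)
  show "T \<sqinter> x = x" for x
    by (simp add: con_def ite_T)
  show "neg T = F"
    by (simp add: neg_def ite_T)
qed (rule neg_neg neg_con con_assoc con_dis dis_con dis_absorb)+

end

section \<open>Terms, derivations and translations between signatures\<close>

lemma Fun_in_terms_over [simp]: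
  "Fun f ts \<in> terms_over \<Sigma> \<longleftrightarrow> (f, length ts) \<in> \<Sigma> \<and> set ts \<subseteq> terms_over \<Sigma>"
  by (auto intro: terms_over.Fun elim: terms_over.cases)

declare terms_over.Var [simp]

lemma subst_in_terms_over:
  assumes "t \<in> terms_over \<Sigma>" and "\<And>x. \<sigma> x \<in> terms_over \<Sigma>"
  shows "subst \<sigma> t \<in> terms_over \<Sigma>"
  using assms(1) by induction (auto simp: assms(2))

lemma subst_subst: "subst \<sigma> (subst \<tau> t) = subst (\<lambda>x. subst \<sigma> (\<tau> x)) t"
  by (induction t) auto

lemma terms_over_mono:
  assumes "t \<in> terms_over \<Sigma>" and "\<Sigma> \<subseteq> \<Sigma>'"
  shows "t \<in> terms_over \<Sigma>'"
  using assms(1) by induction (use assms(2) in auto)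

lemma derivable_in_terms_over:
  assumes "\<Sigma>, E \<turnstile> s \<doteq> t" and "E \<subseteq> terms_over \<Sigma> \<times> terms_over \<Sigma>"
  shows "s \<in> terms_over \<Sigma> \<and> t \<in> terms_over \<Sigma>"
  using assms(1)
proof induction
  case (axiom l r \<sigma>)
  then show ?case
    using assms(2) by (auto intro!: subst_in_terms_over)
next
  case (cong f ss ts)
  then show ?case
    by (auto simp: list_all2_conv_all_nth in_set_conv_nth)
qed auto

lemma derivable_subst:
  assumes "\<Sigma>, E \<turnstile> s \<doteq> t" and "\<And>x. \<sigma> x \<in> terms_over \<Sigma>"
  shows "\<Sigma>, E \<turnstile> subst \<sigma> s \<doteq> subst \<sigma> t"
  using assms(1)
proof induction
  case (axiom l r \<tau>)
  then show ?case
    by (auto simp: subst_subst assms(2) intro!: derivable.axiom subst_in_terms_over)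
next
  case (refl t)
  then show ?case
    by (intro derivable.refl subst_in_terms_over assms(2))
next
  case (cong f ss ts)
  then show ?case
    by (auto simp: list_all2_map1 list_all2_map2 intro!: derivable.cong elim!: list_all2_mono)
qed (blast intro: derivable.sym derivable.trans)+

lemma derivable_signature_mono:
  assumes "\<Sigma>, E \<turnstile> s \<doteq> t" and "\<Sigma> \<subseteq> \<Sigma>'"
  shows "\<Sigma>', E \<turnstile> s \<doteq> t"
  using assms(1)
proof induction
  case (axiom l r \<sigma>)
  then show ?case
    using assms(2) by (blast intro: derivable.axiom terms_over_mono)
next
  case (refl t)
  then show ?case
    using assms(2) by (blast intro: derivable.refl terms_over_mono)
next
  case (cong f ss ts)
  then show ?case
    using assms(2) by (auto intro!: derivable.cong elim!: list_all2_mono)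
qed (blast intro: derivable.sym derivable.trans)+

primrec translate :: "('f \<Rightarrow> 'g trm list \<Rightarrow> 'g trm) \<Rightarrow> 'f trm \<Rightarrow> 'g trm" where
  "translate h (Var x) = Var x"
| "translate h (Fun f ts) = h f (map (translate h) ts)"

lemma translate_id:
  assumes "t \<in> terms_over \<Sigma>" and "\<And>f ts. (f, length ts) \<in> \<Sigma> \<Longrightarrow> h f ts = Fun f ts"
  shows "translate h t = t"
  using assms(1)
proof induction
  case (Fun f ts)
  then show ?case
    by (simp add: assms(2) map_idI)
qed simp

lemma translate_subst:
  assumes "\<And>\<sigma> f ts. subst \<sigma> (h f ts) = h f (map (subst \<sigma>) ts)"
  shows "translate h (subst \<sigma> t) = subst (\<lambda>x. translate h (\<sigma> x)) (translate h t)"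
  by (induction t) (simp_all add: assms comp_def cong: map_cong)

text \<open>Induction on the derivation: \<open>h_subst\<close> and \<open>axioms\<close> handle
  axiom instances, \<open>h_cong\<close> handles congruence.\<close>

lemma derivable_translate:
  assumes derivation: "\<Sigma>, E \<turnstile> s \<doteq> t"
    and over: "E' \<subseteq> terms_over \<Sigma>' \<times> terms_over \<Sigma>'"
    and h_subst: "\<And>\<sigma> f ts. subst \<sigma> (h f ts) = h f (map (subst \<sigma>) ts)"
    and h_cong: "\<And>f ss ts. (f, length ss) \<in> \<Sigma> \<Longrightarrow> list_all2 (\<lambda>s t. \<Sigma>', E' \<turnstile> s \<doteq> t) ss ts
      \<Longrightarrow> \<Sigma>', E' \<turnstile> h f ss \<doteq> h f ts"
    and axioms: "\<And>l r. (l \<approx> r) \<in> E \<Longrightarrow> \<Sigma>', E' \<turnstile> translate h l \<doteq> translate h r"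
  shows "\<Sigma>', E' \<turnstile> translate h s \<doteq> translate h t"
proof -
  have refl: "\<Sigma>', E' \<turnstile> translate h t \<doteq> translate h t" if "t \<in> terms_over \<Sigma>" for t
    using that
  proof induction
    case (Var x)
    then show ?case
      by (simp add: derivable.refl)
  next
    case (Fun f ts)
    then show ?case
      by (auto intro!: h_cong simp: list_all2_conv_all_nth)
  qed
  \<comment> \<open>Only terms over \<open>\<Sigma>'\<close> occur in derivations from
    \<open>E'\<close>, so reflexivity already certifies membership.\<close>
  have closed: "translate h t \<in> terms_over \<Sigma>'" if "t \<in> terms_over \<Sigma>" for t
    using derivable_in_terms_over[OF refl[OF that] over] by simp
  from derivation show ?thesis
  proof induction
    case (axiom l r \<sigma>)
    then show ?case
      by (simp add: translate_subst[OF h_subst] derivable_subst axioms closed)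
  next
    case (cong f ss ts)
    then show ?case
      by (auto intro!: h_cong simp: list_all2_map1 list_all2_map2 elim!: list_all2_mono)
  qed (blast intro: refl derivable.sym derivable.trans)+
qed

text \<open>The default \<open>Var x\<close> keeps every value over the signature once the list
  entries are, as the rule \<open>axiom\<close> demands.\<close>

definition assign :: "'f trm list \<Rightarrow> nat \<Rightarrow> 'f trm" where
  "assign ts x = (if x < length ts then ts ! x else Var x)"

lemma derivable_axioms_assign:
  assumes "set ts \<subseteq> terms_over \<Sigma>" and "E \<subseteq> E'"
  shows "\<forall>(l, r) \<in> E. \<Sigma>, E' \<turnstile> subst (assign ts) l \<doteq> subst (assign ts) r"
  using assms by (auto intro!: derivable.axiom simp: assign_def subset_iff)

lemma derivable_Fun1:
  "(f, 1) \<in> \<Sigma> \<Longrightarrow> \<Sigma>, E \<turnstile> x \<doteq> x' \<Longrightarrow> \<Sigma>, E \<turnstile> Fun f [x] \<doteq> Fun f [x']"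
  by (rule derivable.cong) auto

lemma derivable_Fun2:
  "(f, 2) \<in> \<Sigma> \<Longrightarrow> \<Sigma>, E \<turnstile> x \<doteq> x' \<Longrightarrow> \<Sigma>, E \<turnstile> y \<doteq> y'
    \<Longrightarrow> \<Sigma>, E \<turnstile> Fun f [x, y] \<doteq> Fun f [x', y']"
  by (rule derivable.cong) (auto simp: numeral_2_eq_2)

lemma derivable_Fun3:
  "(f, 3) \<in> \<Sigma> \<Longrightarrow> \<Sigma>, E \<turnstile> x \<doteq> x' \<Longrightarrow> \<Sigma>, E \<turnstile> y \<doteq> y' \<Longrightarrow> \<Sigma>, E \<turnstile> z \<doteq> z'
    \<Longrightarrow> \<Sigma>, E \<turnstile> Fun f [x, y, z] \<doteq> Fun f [x', y', z']"
  by (rule derivable.cong) (auto simp: numeral_3_eq_3)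

section \<open>The free algebras of the two theories\<close>

lemma Sigma_SCL_arities [simp]:
  "(ConjS, n) \<in> Sigma_SCL A \<longleftrightarrow> n = 2" "(DisjS, n) \<in> Sigma_SCL A \<longleftrightarrow> n = 2"
  "(NegS, n) \<in> Sigma_SCL A \<longleftrightarrow> n = 1" "(TrueS, n) \<in> Sigma_SCL A \<longleftrightarrow> n = 0"
  "(FalseS, n) \<in> Sigma_SCL A \<longleftrightarrow> n = 0" "(CondS, n) \<notin> Sigma_SCL A"
  by (auto simp: Sigma_SCL_def)

lemma Sigma_combined_arities [simp]:
  "(ConjS, n) \<in> Sigma_combined A \<longleftrightarrow> n = 2" "(DisjS, n) \<in> Sigma_combined A \<longleftrightarrow> n = 2"
  "(NegS, n) \<in> Sigma_combined A \<longleftrightarrow> n = 1" "(TrueS, n) \<in> Sigma_combined A \<longleftrightarrow> n = 0"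
  "(FalseS, n) \<in> Sigma_combined A \<longleftrightarrow> n = 0" "(CondS, n) \<in> Sigma_combined A \<longleftrightarrow> n = 3"
  by (auto simp: Sigma_combined_def)

lemma CL2_over: "CL2 \<subseteq> terms_over (Sigma_SCL A) \<times> terms_over (Sigma_SCL A)"
  by (simp add: CL2_def Let_def)

lemma ClSCL2_equations_over:
  "ClSCL2_equations \<subseteq> terms_over (Sigma_combined A) \<times> terms_over (Sigma_combined A)"
  by (simp add: ClSCL2_equations_def CP_cl_def CP_mem_def CP_def Let_def)

text \<open>Transfer from a partial quotient states well-formedness as self-relatedness; this
  matches the two forms.\<close>

lemma terms_over_iff_derivable_refl:
  assumes "E \<subseteq> terms_over \<Sigma> \<times> terms_over \<Sigma>"
  shows "t \<in> terms_over \<Sigma> \<longleftrightarrow> (\<Sigma>, E \<turnstile> t \<doteq> t)"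
  using assms by (blast intro: derivable.refl dest: derivable_in_terms_over)

lemma part_equivp_derivable: "part_equivp (\<lambda>s t. \<Sigma>, E \<turnstile> s \<doteq> t)"
  by (rule part_equivpI)
    (auto intro!: exI[of _ "Var 0"] sympI transpI derivable.refl intro: derivable.sym derivable.trans)

\<comment> \<open>Partial because terms outside the signature are related to nothing. The variables
  are the free generators.\<close>
quotient_type 'a free_c_algebra = "'a symbol trm" / partial: "\<lambda>s t. Sigma_SCL {}, CL2 \<turnstile> s \<doteq> t"
  by (rule part_equivp_derivable)

quotient_type 'a free_ite_algebra = "'a symbol trm"
  / partial: "\<lambda>s t. Sigma_combined {}, ClSCL2_equations \<turnstile> s \<doteq> t"
  by (rule part_equivp_derivable)

lift_definition c_neg :: "'a free_c_algebra \<Rightarrow> 'a free_c_algebra" is "\<lambda>x. \<^bold>\<not> x"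
  by (rule derivable_Fun1) simp_all
lift_definition c_con :: "'a free_c_algebra \<Rightarrow> 'a free_c_algebra \<Rightarrow> 'a free_c_algebra"
  is "\<lambda>x y. x \<^bold>\<and> y"
  by (rule derivable_Fun2) simp_all
lift_definition c_dis :: "'a free_c_algebra \<Rightarrow> 'a free_c_algebra \<Rightarrow> 'a free_c_algebra"
  is "\<lambda>x y. x \<^bold>\<or> y"
  by (rule derivable_Fun2) simp_all
lift_definition c_T :: "'a free_c_algebra" is tT
  by (rule derivable.refl) simp
lift_definition c_F :: "'a free_c_algebra" is tF
  by (rule derivable.refl) simp

lift_definition i_ite :: "'a free_ite_algebra \<Rightarrow> 'a free_ite_algebra \<Rightarrow> 'a free_ite_algebra \<Rightarrow> 'a free_ite_algebra"
  is "\<lambda>x y z. x \<lhd> y \<rhd> z"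
  by (rule derivable_Fun3) simp_all
lift_definition i_neg :: "'a free_ite_algebra \<Rightarrow> 'a free_ite_algebra"
  is "\<lambda>x. \<^bold>\<not> x"
  by (rule derivable_Fun1) simp_all
lift_definition i_con :: "'a free_ite_algebra \<Rightarrow> 'a free_ite_algebra \<Rightarrow> 'a free_ite_algebra"
  is "\<lambda>x y. x \<^bold>\<and> y"
  by (rule derivable_Fun2) simp_all
lift_definition i_dis :: "'a free_ite_algebra \<Rightarrow> 'a free_ite_algebra \<Rightarrow> 'a free_ite_algebra"
  is "\<lambda>x y. x \<^bold>\<or> y"
  by (rule derivable_Fun2) simp_all
lift_definition i_T :: "'a free_ite_algebra" is tT
  by (rule derivable.refl) simp
lift_definition i_F :: "'a free_ite_algebra" is tF
  by (rule derivable.refl) simp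

lemma CL2_instances:
  assumes "x \<in> terms_over \<Sigma>" "y \<in> terms_over \<Sigma>" "z \<in> terms_over \<Sigma>" and "CL2 \<subseteq> E"
  shows "\<Sigma>, E \<turnstile> \<^bold>\<not> (\<^bold>\<not> x) \<doteq> x"
    and "\<Sigma>, E \<turnstile> \<^bold>\<not> (x \<^bold>\<and> y) \<doteq> \<^bold>\<not> x \<^bold>\<or> \<^bold>\<not> y"
    and "\<Sigma>, E \<turnstile> (x \<^bold>\<and> y) \<^bold>\<and> z \<doteq> x \<^bold>\<and> (y \<^bold>\<and> z)"
    and "\<Sigma>, E \<turnstile> x \<^bold>\<and> (y \<^bold>\<or> z) \<doteq> (x \<^bold>\<and> y) \<^bold>\<or> (x \<^bold>\<and> z)"
    and "\<Sigma>, E \<turnstile> (x \<^bold>\<or> y) \<^bold>\<and> z \<doteq> (x \<^bold>\<and> z) \<^bold>\<or> (\<^bold>\<not> x \<^bold>\<and> (y \<^bold>\<and> z))"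
    and "\<Sigma>, E \<turnstile> x \<^bold>\<or> (x \<^bold>\<and> y) \<doteq> x"
    and "\<Sigma>, E \<turnstile> (x \<^bold>\<and> y) \<^bold>\<or> (y \<^bold>\<and> x) \<doteq> (y \<^bold>\<and> x) \<^bold>\<or> (x \<^bold>\<and> y)"
    and "\<Sigma>, E \<turnstile> tT \<^bold>\<and> x \<doteq> x"
    and "\<Sigma>, E \<turnstile> \<^bold>\<not> tT \<doteq> tF"
  using derivable_axioms_assign[of "[x, y, z]" \<Sigma> CL2 E] assms
  by (simp_all add: CL2_def Let_def assign_def)

lemma ClSCL2_equations_instances:
  assumes "x \<in> terms_over \<Sigma>" "y \<in> terms_over \<Sigma>" "z \<in> terms_over \<Sigma>"
    and "u \<in> terms_over \<Sigma>" "v \<in> terms_over \<Sigma>" "w \<in> terms_over \<Sigma>"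
    and "ClSCL2_equations \<subseteq> E"
  shows "\<Sigma>, E \<turnstile> x \<lhd> tT \<rhd> y \<doteq> x"
    and "\<Sigma>, E \<turnstile> x \<lhd> tF \<rhd> y \<doteq> y"
    and "\<Sigma>, E \<turnstile> tT \<lhd> x \<rhd> tF \<doteq> x"
    and "\<Sigma>, E \<turnstile> x \<lhd> (y \<lhd> z \<rhd> u) \<rhd> v \<doteq> (x \<lhd> y \<rhd> v) \<lhd> z \<rhd> (x \<lhd> u \<rhd> v)"
    and "\<Sigma>, E \<turnstile> x \<lhd> y \<rhd> (z \<lhd> u \<rhd> (v \<lhd> y \<rhd> w)) \<doteq> x \<lhd> y \<rhd> (z \<lhd> u \<rhd> w)"
    and "\<Sigma>, E \<turnstile> (x \<lhd> y \<rhd> z) \<lhd> u \<rhd> (v \<lhd> y \<rhd> w) \<doteq> (x \<lhd> u \<rhd> v) \<lhd> y \<rhd> (z \<lhd> u \<rhd> w)"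
    and "\<Sigma>, E \<turnstile> \<^bold>\<not> x \<doteq> tF \<lhd> x \<rhd> tT"
    and "\<Sigma>, E \<turnstile> x \<^bold>\<and> y \<doteq> y \<lhd> x \<rhd> tF"
    and "\<Sigma>, E \<turnstile> x \<^bold>\<or> y \<doteq> \<^bold>\<not> (\<^bold>\<not> x \<^bold>\<and> \<^bold>\<not> y)"
  using derivable_axioms_assign[of "[x, y, z, u, v, w]" \<Sigma> ClSCL2_equations E] assms
  by (simp_all add: ClSCL2_equations_def CP_cl_def CP_mem_def CP_def Let_def assign_def)

text \<open>Each locale axiom transfers to one instance lemma; its parameters that do not occur in
  the goal are filled with variables.\<close>

interpretation c: c_algebra c_neg c_con c_dis c_T c_F
  by (unfold_locales; transfer;
    rule CL2_instances[where \<Sigma> = "Sigma_SCL {}" and E = CL2,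
      unfolded terms_over_iff_derivable_refl[OF CL2_over], OF _ _ _ order_refl];
    (assumption | rule derivable.refl[OF terms_over.Var]))

interpretation i: ite_algebra i_ite i_neg i_con i_dis i_T i_F
  by (unfold_locales; transfer;
    rule ClSCL2_equations_instances[where \<Sigma> = "Sigma_combined {}" and E = ClSCL2_equations,
      unfolded terms_over_iff_derivable_refl[OF ClSCL2_equations_over], OF _ _ _ _ _ _ order_refl];
    (assumption | rule derivable.refl[OF terms_over.Var]))

text \<open>Turns derivability into equality in the free algebra, where the locale's identities
  apply.\<close>

lemma abs_free_c_algebra_eq_iff:
  assumes "s \<in> terms_over (Sigma_SCL {})" "t \<in> terms_over (Sigma_SCL {})"
  shows "(Sigma_SCL {}, CL2 \<turnstile> s \<doteq> t) \<longleftrightarrow> abs_free_c_algebra s = abs_free_c_algebra t"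
  using Quotient_rel[OF Quotient_free_c_algebra, of s t] assms by (simp add: derivable.refl)

lemma abs_free_c_algebra_simps:
  shows "x \<in> terms_over (Sigma_SCL {}) \<Longrightarrow> abs_free_c_algebra (\<^bold>\<not> x) = c_neg (abs_free_c_algebra x)"
    and "x \<in> terms_over (Sigma_SCL {}) \<Longrightarrow> y \<in> terms_over (Sigma_SCL {}) \<Longrightarrow>
      abs_free_c_algebra (x \<^bold>\<and> y) = c_con (abs_free_c_algebra x) (abs_free_c_algebra y)"
    and "x \<in> terms_over (Sigma_SCL {}) \<Longrightarrow> y \<in> terms_over (Sigma_SCL {}) \<Longrightarrow>
      abs_free_c_algebra (x \<^bold>\<or> y) = c_dis (abs_free_c_algebra x) (abs_free_c_algebra y)"
    and "abs_free_c_algebra tT = c_T" and "abs_free_c_algebra tF = c_F"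
  by (simp_all add: c_neg.abs_eq c_con.abs_eq c_dis.abs_eq c_T.abs_eq c_F.abs_eq derivable.refl)

lemma abs_free_ite_algebra_eq_iff:
  assumes "s \<in> terms_over (Sigma_combined {})" "t \<in> terms_over (Sigma_combined {})"
  shows "(Sigma_combined {}, ClSCL2_equations \<turnstile> s \<doteq> t) \<longleftrightarrow> abs_free_ite_algebra s = abs_free_ite_algebra t"
  using Quotient_rel[OF Quotient_free_ite_algebra, of s t] assms by (simp add: derivable.refl)

lemma abs_free_ite_algebra_simps:
  shows "x \<in> terms_over (Sigma_combined {}) \<Longrightarrow> abs_free_ite_algebra (\<^bold>\<not> x) = i_neg (abs_free_ite_algebra x)"
    and "x \<in> terms_over (Sigma_combined {}) \<Longrightarrow> y \<in> terms_over (Sigma_combined {}) \<Longrightarrow>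
      abs_free_ite_algebra (x \<^bold>\<and> y) = i_con (abs_free_ite_algebra x) (abs_free_ite_algebra y)"
    and "x \<in> terms_over (Sigma_combined {}) \<Longrightarrow> y \<in> terms_over (Sigma_combined {}) \<Longrightarrow>
      abs_free_ite_algebra (x \<^bold>\<or> y) = i_dis (abs_free_ite_algebra x) (abs_free_ite_algebra y)"
    and "abs_free_ite_algebra tT = i_T" and "abs_free_ite_algebra tF = i_F"
  by (simp_all add: i_neg.abs_eq i_con.abs_eq i_dis.abs_eq i_T.abs_eq i_F.abs_eq derivable.refl)

section \<open>Eliminating the conditional and comparing the theories\<close>

fun elim_cond :: "'a symbol \<Rightarrow> 'a symbol trm list \<Rightarrow> 'a symbol trm" where
  "elim_cond CondS [x, y, z] = (y \<^bold>\<and> x) \<^bold>\<or> (\<^bold>\<not> y \<^bold>\<and> z)"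
| "elim_cond f ts = Fun f ts"

lemma subst_elim_cond: "subst \<sigma> (elim_cond f ts) = elim_cond f (map (subst \<sigma>) ts)"
  by (cases "(f, ts)" rule: elim_cond.cases) auto

lemma elim_cond_cong:
  assumes "(f, length ss) \<in> Sigma_combined A" and "list_all2 (\<lambda>s t. Sigma_SCL A, CL2 \<turnstile> s \<doteq> t) ss ts"
  shows "Sigma_SCL A, CL2 \<turnstile> elim_cond f ss \<doteq> elim_cond f ts"
proof (cases "f = CondS")
  case True
  with assms obtain x y z x' y' z' where
    "ss = [x, y, z]" "ts = [x', y', z']"
    "Sigma_SCL A, CL2 \<turnstile> x \<doteq> x'" "Sigma_SCL A, CL2 \<turnstile> y \<doteq> y'" "Sigma_SCL A, CL2 \<turnstile> z \<doteq> z'"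
    by (auto simp: numeral_3_eq_3 length_Suc_conv list_all2_Cons1)
  with True show ?thesis
    by (simp add: derivable_Fun1 derivable_Fun2)
next
  case False
  then have "elim_cond f us = Fun f us" for us :: "'a symbol trm list"
    by (cases f) simp_all
  with False assms show ?thesis
    by (auto simp: Sigma_combined_def intro: derivable.cong)
qed

text \<open>\<open>elim_cond\<close> uses the defining term of \<open>c.ite\<close>, so each
  translated axiom becomes an identity already shown in every C-algebra.\<close>

lemma ClSCL2_equations_elim_cond:
  assumes "(l \<approx> r) \<in> ClSCL2_equations"
  shows "Sigma_SCL A, CL2 \<turnstile> translate elim_cond l \<doteq> translate elim_cond r"
proof (rule derivable_signature_mono)
  show "Sigma_SCL {}, CL2 \<turnstile> translate elim_cond l \<doteq> translate elim_cond r"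
    using assms unfolding ClSCL2_equations_def CP_cl_def CP_mem_def CP_def Let_def
    by (auto simp: abs_free_c_algebra_eq_iff abs_free_c_algebra_simps c.neg_con c.neg_neg
        simp flip: c.ite_def
        intro: c.ite_T c.ite_F c.T_ite_F c.ite_ite c.ite_memory c.ite_exchange
          c.neg_eq_ite c.con_eq_ite c.neg_T[symmetric])
qed (auto simp: Sigma_SCL_def)

lemma CL2_derivable_from_ClSCL2_equations:
  assumes "(l \<approx> r) \<in> CL2"
  shows "Sigma_combined A, ClSCL2_equations \<turnstile> l \<doteq> r"
proof (rule derivable_signature_mono)
  interpret c: c_algebra i_neg i_con i_dis i_T i_F
    by (rule i.c_algebra)
  show "Sigma_combined {}, ClSCL2_equations \<turnstile> l \<doteq> r"
    using assms unfolding CL2_def Let_def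
    by (auto simp: abs_free_ite_algebra_eq_iff abs_free_ite_algebra_simps c.neg_neg c.neg_con
      c.con_assoc c.con_dis c.dis_con c.dis_absorb c.T_con c.neg_T intro: c.comm)
qed (auto simp: Sigma_combined_def Sigma_SCL_def)

theorem theorem3p13:
  fixes A :: "'a set" and s t :: "'a symbol trm"
  assumes "s \<in> terms_over (Sigma_SCL A)" and "t \<in> terms_over (Sigma_SCL A)"
  shows "CL2_derives A s t \<longleftrightarrow> ClSCL2_derives A s t"
proof
  \<comment> \<open>The identity translation lets \<open>derivable_translate\<close> change axioms
    and signature at once.\<close>
  have Fun_id: "translate Fun t = t" if "t \<in> terms_over (Sigma_SCL A)" for t :: "'a symbol trm"
    using that by (rule translate_id) simp
  assume "CL2_derives A s t"
  then have "Sigma_combined A, ClSCL2_equations \<turnstile> translate Fun s \<doteq> translate Fun t"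
    unfolding CL2_derives_def
  proof (rule derivable_translate[OF _ ClSCL2_equations_over])
    show "Sigma_combined A, ClSCL2_equations \<turnstile> translate Fun l \<doteq> translate Fun r"
      if "(l \<approx> r) \<in> CL2" for l r
      using that CL2_over[of A] CL2_derivable_from_ClSCL2_equations[OF that] by (auto simp: Fun_id)
  qed (auto simp: Sigma_combined_def intro: derivable.cong)
  with assms show "ClSCL2_derives A s t"
    by (simp add: ClSCL2_derives_def Fun_id)
next
  \<comment> \<open>The end terms contain no conditional, so elimination alters only the interior of
    the derivation.\<close>
  have elim_cond_id: "translate elim_cond t = t" if "t \<in> terms_over (Sigma_SCL A)" for t :: "'a symbol trm"
    using that
  proof (rule translate_id)
    show "elim_cond f ts = Fun f ts"
      if "(f, length ts) \<in> Sigma_SCL A" for f and ts :: "'a symbol trm list"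
      using that by (cases f) auto
  qed
  assume "ClSCL2_derives A s t"
  then have "Sigma_combined A, ClSCL2_equations \<turnstile> s \<doteq> t"
    by (simp add: ClSCL2_derives_def)
  then have "Sigma_SCL A, CL2 \<turnstile> translate elim_cond s \<doteq> translate elim_cond t"
    by (rule derivable_translate[OF _ CL2_over subst_elim_cond elim_cond_cong ClSCL2_equations_elim_cond])
  with assms show "CL2_derives A s t"
    by (simp add: CL2_derives_def elim_cond_id)
qed

end
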